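(* Let $\Omega\subset\mathbb{R}^n$ be a bounded open set with $C^{1,\gamma}$-boundary. Then $\mu$ is subadditive on $\mathcal{E}$, i.e. $$\mu(E\cup F)\le\mu(E)+\mu(F)\qquad\text{for any }E,F\in\mathcal{E}.$$
   Context: For $s\in(0,1)$ and measurable $A,B\subseteq\mathbb{R}^n$, set $L(A,B):=\int_A\int_B\frac{1}{|x-y|^{n+s}}\,dx\,dy$ (with $L(A,B)=0$ if $A$ or $B$ is empty). Write $\mathcal{C}E=\mathbb{R}^n\setminus E$. The $s$-perimeter of a measurable set $E\subseteq\mathbb{R}^n$ in $\Omega$ is $$\mathrm{Per}_s(E;\Omega):=L(E\cap\Omega,(\mathcal{C}E)\cap\Omega)+L(E\cap\Omega,(\mathcal{C}E)\cap(\mathcal{C}\Omega))+L(E\cap(\mathcal{C}\Omega),(\mathcal{C}E)\cap\Omega).$$ Define $\mu(E):=\lim_{s\searrow0}s\,\mathrm{Per}_s(E;\Omega)$ whenever the limit exists, and let $\mathcal{E}$ be the family of sets $E\subseteq\mathbb{R}^n$ for which the limit defining $\mu(E)$ exists.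
   Formalization: The union E∪F is additionally assumed to belong to the family 𝓔, since 𝓔 is not closed under unions and μ(E∪F) may otherwise be undefined; limits are taken in [0,∞]. *)

theory Defs
  imports "HOL-Analysis.Analysis"
begin

definition L_int :: "real \<Rightarrow> (real^'n) set \<Rightarrow> (real^'n) set \<Rightarrow> ennreal" where
  "L_int s A B =
     (\<integral>\<^sup>+y\<in>A. (\<integral>\<^sup>+x\<in>B. 1 / ennreal (norm (x - y) powr (real CARD('n) + s)) \<partial>lebesgue) \<partial>lebesgue)"

definition Per :: "real \<Rightarrow> (real^'n) set \<Rightarrow> (real^'n) set \<Rightarrow> ennreal" where
  "Per s E \<Omega> = L_int s (E \<inter> \<Omega>) ((- E) \<inter> \<Omega>)
     + L_int s (E \<inter> \<Omega>) ((- E) \<inter> (- \<Omega>))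
     + L_int s (E \<inter> (- \<Omega>)) ((- E) \<inter> \<Omega>)"

text \<open>The fractional perimeter may be infinite, so the limit is taken in \<open>[0, \<infinity>]\<close>.\<close>

definition mu_dom :: "(real^'n) set \<Rightarrow> (real^'n) set set" where
  "mu_dom \<Omega> = {E \<in> sets lebesgue. \<exists>l. ((\<lambda>s. ennreal s * Per s E \<Omega>) \<longlongrightarrow> l) (at_right 0)}"

text \<open>Meaningful only for members of \<open>mu_dom \<Omega>\<close>; \<open>Lim\<close> is unspecified elsewhere.\<close>

definition mu :: "(real^'n) set \<Rightarrow> (real^'n) set \<Rightarrow> ennreal" where
  "mu \<Omega> E = Lim (at_right 0) (\<lambda>s. ennreal s * Per s E \<Omega>)"

definition C1_holder :: "real \<Rightarrow> ('a::euclidean_space \<Rightarrow> real) \<Rightarrow> bool" where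
  "C1_holder \<gamma> f \<longleftrightarrow> (\<exists>g C. (\<forall>x. (f has_derivative (\<lambda>h. g x \<bullet> h)) (at x)) \<and>
      (\<forall>x y. norm (g x - g y) \<le> C * norm (x - y) powr \<gamma>))"

text \<open>Near each boundary point, \<open>\<Omega>\<close> is the part of a ball lying on one side of the graph of a
  \<open>C\<^sup>1\<^sup>,\<^sup>\<gamma>\<close> function over a hyperplane with unit normal \<open>e\<close>.  The function \<open>\<psi>\<close> is
  defined on all of \<open>\<real>\<^sup>n\<close>, but only its values on the hyperplane orthogonal to \<open>e\<close> are used;
  restrictions of \<open>C\<^sup>1\<^sup>,\<^sup>\<gamma>\<close> functions to the hyperplane are exactly the \<open>C\<^sup>1\<^sup>,\<^sup>\<gamma>\<close>
  functions of \<open>n - 1\<close> variables.  Asking for a single Hoelder constant on all of space is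
  harmless, since \<open>\<psi>\<close> can be cut off away from the ball.\<close>

definition C1_holder_boundary :: "real \<Rightarrow> (real^'n) set \<Rightarrow> bool" where
  "C1_holder_boundary \<gamma> \<Omega> \<longleftrightarrow> (\<forall>p \<in> frontier \<Omega>. \<exists>r>0. \<exists>e \<psi>. norm e = 1 \<and> C1_holder \<gamma> \<psi> \<and>
      \<Omega> \<inter> ball p r = {x \<in> ball p r. x \<bullet> e > \<psi> (x - (x \<bullet> e) *\<^sub>R e)})"

end

theory Submission
  imports Defs
begin

text \<open>For each fixed \<open>s\<close> the perimeter is already subadditive, because \<open>L_int\<close> is subadditive in
  its first argument and monotone in both, and the inequality survives the limit.\<close>

text \<open>The integrand need not be measurable: \<open>nn_integral\<close> is a supremum over simple functions
  below it, and only these have to be split.\<close>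

lemma set_nn_integral_Un_le:
  assumes A: "A \<in> sets M" and B: "B \<in> sets M"
  shows "(\<integral>\<^sup>+x\<in>A \<union> B. f x \<partial>M) \<le> (\<integral>\<^sup>+x\<in>A. f x \<partial>M) + (\<integral>\<^sup>+x\<in>B. f x \<partial>M)"
  unfolding nn_integral_def[of M "\<lambda>x. f x * indicator (A \<union> B) x"]
proof (rule SUP_least, clarify)
  fix g assume g: "simple_function M g" and le: "g \<le> (\<lambda>x. f x * indicator (A \<union> B) x)"
  have [measurable]: "g \<in> borel_measurable M"
    using g by (rule borel_measurable_simple_function)
  have g0: "g x = 0" if "x \<notin> A \<union> B" for x
    using le that by (auto simp: le_fun_def indicator_def dest: spec[of _ x])
  have gf: "g x \<le> f x" if "x \<in> A \<union> B" for x
    using le that by (auto simp: le_fun_def indicator_def dest: spec[of _ x])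
  have "integral\<^sup>S M g = (\<integral>\<^sup>+x. g x \<partial>M)"
    using g by (rule nn_integral_eq_simple_integral[symmetric])
  \<comment> \<open>Off the union \<open>g\<close> vanishes; on the overlap of \<open>A\<close> and
    \<open>B\<close> it is counted twice, hence only an inequality. Additivity applies next because
    \<open>g\<close>, unlike \<open>f\<close>, is measurable.\<close>
  also have "\<dots> \<le> (\<integral>\<^sup>+x. g x * indicator A x + g x * indicator B x \<partial>M)"
    using g0 by (intro nn_integral_mono) (auto simp: indicator_def)
  also have "\<dots> = (\<integral>\<^sup>+x\<in>A. g x \<partial>M) + (\<integral>\<^sup>+x\<in>B. g x \<partial>M)"
    using A B by (intro nn_integral_add) auto
  also have "\<dots> \<le> (\<integral>\<^sup>+x\<in>A. f x \<partial>M) + (\<integral>\<^sup>+x\<in>B. f x \<partial>M)"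
    using gf by (intro add_mono nn_integral_mono) (auto simp: indicator_def)
  finally show "integral\<^sup>S M g \<le> (\<integral>\<^sup>+x\<in>A. f x \<partial>M) + (\<integral>\<^sup>+x\<in>B. f x \<partial>M)" .
qed

lemma L_int_mono: "A \<subseteq> A' \<Longrightarrow> B \<subseteq> B' \<Longrightarrow> L_int s A B \<le> L_int s A' B'"
  unfolding L_int_def
  by (intro nn_integral_mono mult_mono) (auto simp: indicator_def)

text \<open>Two targets \<open>B\<close> and \<open>B'\<close> are allowed because the complement of
  a union lies in both complements, so each piece may be enlarged separately.\<close>

lemma L_int_Un_le:
  assumes "A \<in> sets lebesgue" "A' \<in> sets lebesgue" "C \<subseteq> B" "C \<subseteq> B'"
  shows "L_int s (A \<union> A') C \<le> L_int s A B + L_int s A' B'"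
proof -
  have "L_int s (A \<union> A') C \<le> L_int s A C + L_int s A' C"
    unfolding L_int_def using assms(1,2) by (rule set_nn_integral_Un_le)
  also have "\<dots> \<le> L_int s A B + L_int s A' B'"
    using assms(3,4) by (intro add_mono L_int_mono) auto
  finally show ?thesis .
qed

lemma Per_Un_le:
  assumes [measurable]: "E \<in> sets lebesgue" "F \<in> sets lebesgue" "\<Omega> \<in> sets lebesgue"
  shows "Per s (E \<union> F) \<Omega> \<le> Per s E \<Omega> + Per s F \<Omega>"
proof -
  \<comment> \<open>The three summands of \<open>Per\<close> are the cases (\<open>\<Omega>\<close>,
    \<open>\<Omega>\<close>), (\<open>\<Omega>\<close>, \<open>- \<Omega>\<close>) and
    (\<open>- \<Omega>\<close>, \<open>\<Omega>\<close>) of (\<open>S\<close>, \<open>T\<close>).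
    Only the first argument is split, so \<open>T\<close> may be any set.\<close>
  have "L_int s ((E \<union> F) \<inter> S) (- (E \<union> F) \<inter> T) \<le>
      L_int s (E \<inter> S) (- E \<inter> T) + L_int s (F \<inter> S) (- F \<inter> T)"
    if [measurable]: "S \<in> sets lebesgue" for S T
    unfolding Int_Un_distrib2 by (rule L_int_Un_le) auto
  from add_mono[OF add_mono[OF this[of \<Omega> \<Omega>] this[of \<Omega> "- \<Omega>"]] this[of "- \<Omega>" \<Omega>]]
  show ?thesis
    using assms(3) by (simp add: Per_def Compl_in_sets_lebesgue add_ac)
qed

text \<open>Limits in \<open>ennreal\<close> are unique along the nontrivial filter
  \<open>at_right 0\<close>, so \<open>Lim\<close> picks the limit that membership provides.\<close>

lemma mu_dom_tendsto:
  assumes "E \<in> mu_dom \<Omega>"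
  shows "((\<lambda>s. ennreal s * Per s E \<Omega>) \<longlongrightarrow> mu \<Omega> E) (at_right 0)"
proof -
  obtain l where l: "((\<lambda>s. ennreal s * Per s E \<Omega>) \<longlongrightarrow> l) (at_right 0)"
    using assms by (auto simp: mu_dom_def)
  then have "mu \<Omega> E = l"
    unfolding mu_def by (intro tendsto_Lim) auto
  with l show ?thesis by simp
qed

theorem proposition2p1:
  fixes \<Omega> E F :: "(real^'n) set" and \<gamma> :: real
  assumes "open \<Omega>" and "bounded \<Omega>"
    and "0 < \<gamma>" and "\<gamma> \<le> 1" and "C1_holder_boundary \<gamma> \<Omega>"
    and "E \<in> mu_dom \<Omega>" and "F \<in> mu_dom \<Omega>" and "E \<union> F \<in> mu_dom \<Omega>"
  shows "mu \<Omega> (E \<union> F) \<le> mu \<Omega> E + mu \<Omega> F"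
proof (rule tendsto_le)
  show "((\<lambda>s. ennreal s * Per s E \<Omega> + ennreal s * Per s F \<Omega>) \<longlongrightarrow> mu \<Omega> E + mu \<Omega> F) (at_right 0)"
    using assms by (intro tendsto_add mu_dom_tendsto)
  \<comment> \<open>Existence of this limit comes from the hypothesis on the union; the pointwise
    bound alone would control only the limsup.\<close>
  show "((\<lambda>s. ennreal s * Per s (E \<union> F) \<Omega>) \<longlongrightarrow> mu \<Omega> (E \<union> F)) (at_right 0)"
    using assms by (intro mu_dom_tendsto)
  have "E \<in> sets lebesgue" "F \<in> sets lebesgue" "\<Omega> \<in> sets lebesgue"
    using assms by (auto simp: mu_dom_def)
  then have "ennreal s * Per s (E \<union> F) \<Omega> \<le> ennreal s * Per s E \<Omega> + ennreal s * Per s F \<Omega>" for s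
    unfolding distrib_left[symmetric] by (intro mult_left_mono Per_Un_le) auto
  then show "\<forall>\<^sub>F s in at_right 0. ennreal s * Per s (E \<union> F) \<Omega>
      \<le> ennreal s * Per s E \<Omega> + ennreal s * Per s F \<Omega>"
    by simp
qed simp

end
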